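(* Let $G=\{g_0,\dots,g_{n-1}\}$ be a finite group, let $\nu\in\mathcal{P}(G)$ be an acyclic probability measure, and let $H$ be the subgroup of $G$ generated by the support of $\nu$. Let $T_\nu(\mu)=\nu*\mu$. Then for every $\mu\in\mathcal{P}(G)$ the $\omega$-limit set of $\mu$ under $T_\nu$ is $$L_\omega(\mu)=\Big\{\Big(\sum_{h\in H}\frac{1}{|H|}\delta_h\Big)*\mu\Big\},$$ and this limit depends linearly on $\mu$. Moreover, $\mu$ is a recurrent point of the dynamics, that is, $\mu\in L_\omega(\mu)$, only if $\mu$ is a solution of the Choquet-Deny equation $$\bar\nu*\mu=\mu,\qquad\text{where } \bar\nu=\lim_{m\to\infty}\nu^{m}.$$
   Context: For a finite group $G=\{g_0,\dots,g_{n-1}\}$ (written multiplicatively, not assumed abelian, $g_0=e$ the identity), $\mathcal{P}(G)$ denotes the set of probability measures $\sum_{i=0}^{n-1}p_i\delta_{g_i}$ with $p_i\in[0,1]$, $\sum_i p_i=1$; it is identified with the standard simplex in $\mathbb{R}^n$, with convergence of coefficients (equivalently the weak topology). The convolution is defined by $(\nu*\mu)(f)=\int_G\int_G f(gh)\,d\nu(g)\,d\mu(h)$ for $f:G\to\mathbb{R}$, and $\nu^m=\nu*\cdots*\nu$ ($m$ factors). The support of $\nu$ is $\mathrm{supp}(\nu)=\{g\in G:\nu(g)>0\}$. For $m\ge1$ put $Z_+(\nu)^m=\{g_{i_1}\cdots g_{i_m}: g_{i_k}\in\mathrm{supp}(\nu)\}$. With $H=\langle\mathrm{supp}(\nu)\rangle$,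 $\nu$ is called acyclic if there exists $N\in\mathbb{N}$, $N\geq1$, such that $Z_+(\nu)^N=H$. The $\omega$-limit set $L_\omega(\mu)$ is the set of accumulation points (limits of subsequences) of the orbit sequence $(T_\nu^m(\mu))_{m\in\mathbb{N}}$. *)

theory Defs
  imports "HOL-Analysis.Function_Topology" "HOL-Algebra.Generated_Groups"
begin

text \<open>
  A (signed) measure on a finite group \<open>G\<close> is represented by its coefficient function
  \<open>'a \<Rightarrow> real\<close>, which vanishes outside the carrier.  With this normalisation the topology
  of pointwise convergence on \<open>'a \<Rightarrow> real\<close> (the product topology of the library) restricts to
  the Euclidean topology on the coefficients \<open>(\<mu> g)\<close> for \<open>g \<in> carrier G\<close>.
\<close>

definition signed_measures :: "('a, 'b) monoid_scheme \<Rightarrow> ('a \<Rightarrow> real) set" where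
  "signed_measures G = {\<mu>. \<forall>g. g \<notin> carrier G \<longrightarrow> \<mu> g = 0}"

definition prob_measures :: "('a, 'b) monoid_scheme \<Rightarrow> ('a \<Rightarrow> real) set" where
  "prob_measures G =
     {\<mu> \<in> signed_measures G. (\<forall>g\<in>carrier G. 0 \<le> \<mu> g \<and> \<mu> g \<le> 1) \<and> (\<Sum>g\<in>carrier G. \<mu> g) = 1}"

definition dirac :: "'a \<Rightarrow> 'a \<Rightarrow> real" where
  "dirac g = indicator {g}"

text \<open>
  The measure with \<open>(\<nu> * \<mu>)(f) = \<integral>\<integral> f (g h) d\<nu>(g) d\<mu>(h)\<close>, i.e. the sum of
  \<open>\<nu>(g) \<mu>(h) \<delta>\<^bsub>gh\<^esub>\<close>; see \<open>integral_conv\<close> below.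
\<close>

definition conv :: "('a, 'b) monoid_scheme \<Rightarrow> ('a \<Rightarrow> real) \<Rightarrow> ('a \<Rightarrow> real) \<Rightarrow> 'a \<Rightarrow> real" where
  "conv G \<nu> \<mu> =
     (\<lambda>x. \<Sum>g\<in>carrier G. \<Sum>h\<in>carrier G. \<nu> g * \<mu> h * dirac (g \<otimes>\<^bsub>G\<^esub> h) x)"

lemma integral_conv:
  assumes "group G" "finite (carrier G)"
  shows "(\<Sum>x\<in>carrier G. conv G \<nu> \<mu> x * f x) =
         (\<Sum>g\<in>carrier G. \<Sum>h\<in>carrier G. \<nu> g * \<mu> h * f (g \<otimes>\<^bsub>G\<^esub> h))"
proof -
  interpret group G by fact
  have point: "(\<Sum>x\<in>carrier G. dirac y x * f x) = f y" if "y \<in> carrier G" for y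
    using that assms(2) by (simp add: dirac_def indicator_def if_distrib cong: if_cong)
  have "(\<Sum>x\<in>carrier G. conv G \<nu> \<mu> x * f x) =
        (\<Sum>x\<in>carrier G. \<Sum>g\<in>carrier G. \<Sum>h\<in>carrier G.
           \<nu> g * \<mu> h * (dirac (g \<otimes>\<^bsub>G\<^esub> h) x * f x))"
    by (simp add: conv_def sum_distrib_right mult.assoc)
  also have "\<dots> = (\<Sum>g\<in>carrier G. \<Sum>x\<in>carrier G. \<Sum>h\<in>carrier G.
           \<nu> g * \<mu> h * (dirac (g \<otimes>\<^bsub>G\<^esub> h) x * f x))"
    by (rule sum.swap)
  also have "\<dots> = (\<Sum>g\<in>carrier G. \<Sum>h\<in>carrier G. \<Sum>x\<in>carrier G.
           \<nu> g * \<mu> h * (dirac (g \<otimes>\<^bsub>G\<^esub> h) x * f x))"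
    by (rule sum.cong[OF refl], rule sum.swap)
  also have "\<dots> = (\<Sum>g\<in>carrier G. \<Sum>h\<in>carrier G. \<nu> g * \<mu> h * f (g \<otimes>\<^bsub>G\<^esub> h))"
    by (intro sum.cong refl) (simp add: sum_distrib_left[symmetric] point)
  finally show ?thesis .
qed

primrec conv_pow :: "('a, 'b) monoid_scheme \<Rightarrow> ('a \<Rightarrow> real) \<Rightarrow> nat \<Rightarrow> 'a \<Rightarrow> real" where
  "conv_pow G \<nu> 0 = dirac \<one>\<^bsub>G\<^esub>"
| "conv_pow G \<nu> (Suc m) = conv G \<nu> (conv_pow G \<nu> m)"

definition supp :: "('a, 'b) monoid_scheme \<Rightarrow> ('a \<Rightarrow> real) \<Rightarrow> 'a set" where
  "supp G \<nu> = {g \<in> carrier G. \<nu> g > 0}"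

definition supp_products :: "('a, 'b) monoid_scheme \<Rightarrow> ('a \<Rightarrow> real) \<Rightarrow> nat \<Rightarrow> 'a set" where
  "supp_products G \<nu> m =
     {foldr (\<otimes>\<^bsub>G\<^esub>) gs \<one>\<^bsub>G\<^esub> | gs. length gs = m \<and> set gs \<subseteq> supp G \<nu>}"

definition acyclic_measure :: "('a, 'b) monoid_scheme \<Rightarrow> ('a \<Rightarrow> real) \<Rightarrow> bool" where
  "acyclic_measure G \<nu> \<longleftrightarrow> (\<exists>N\<ge>1. supp_products G \<nu> N = generate G (supp G \<nu>))"

definition uniform_measure_on :: "'a set \<Rightarrow> 'a \<Rightarrow> real" where
  "uniform_measure_on H = (\<lambda>x. \<Sum>h\<in>H. 1 / real (card H) * dirac h x)"

definition omega_limit :: "('s::topological_space \<Rightarrow> 's) \<Rightarrow> 's \<Rightarrow> 's set" where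
  "omega_limit T x = {y. \<exists>r::nat \<Rightarrow> nat. strict_mono r \<and> (\<lambda>k. (T ^^ r k) x) \<longlonglongrightarrow> y}"

text \<open>
  Linearity on the real vector space of signed measures, spelled out because the library has no
  \<open>real_vector\<close> structure on function types.
\<close>

definition linear_on_measures ::
    "('a, 'b) monoid_scheme \<Rightarrow> (('a \<Rightarrow> real) \<Rightarrow> 'a \<Rightarrow> real) \<Rightarrow> bool" where
  "linear_on_measures G L \<longleftrightarrow>
     (\<forall>\<mu>\<in>signed_measures G. L \<mu> \<in> signed_measures G) \<and>
     (\<forall>\<mu>\<^sub>1\<in>signed_measures G. \<forall>\<mu>\<^sub>2\<in>signed_measures G. \<forall>a b.
        L (\<lambda>g. a * \<mu>\<^sub>1 g + b * \<mu>\<^sub>2 g) = (\<lambda>g. a * L \<mu>\<^sub>1 g + b * L \<mu>\<^sub>2 g))"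

end

theory Submission imports Defs begin

text \<open>
  Let \<open>u\<close> be the uniform measure on \<open>H\<close>.  Acyclicity makes \<open>\<nu>\<^sup>N\<close> charge every point of \<open>H\<close>, so
  \<open>\<nu>\<^sup>N \<ge> c u\<close> for some \<open>c > 0\<close> (a Doeblin minorisation).  The difference \<open>d\<^sub>m = \<nu>\<^sup>m * \<mu> - u * \<mu>\<close>
  satisfies \<open>d\<^bsub>m+1\<^esub> = \<nu> * d\<^sub>m\<close> and \<open>u * d\<^sub>m = 0\<close>, because \<open>\<nu> * u = u * \<nu> = u\<close>.  Its total variation
  is therefore decreasing, and it shrinks by the factor \<open>1 - c\<close> over \<open>N\<close> steps because
  \<open>d\<^bsub>m+N\<^esub> = (\<nu>\<^sup>N - c u) * d\<^sub>m\<close>.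
\<close>

section \<open>Limits in the product topology\<close>

lemma tendsto_pointwise_iff:
  fixes f :: "'i \<Rightarrow> 'a \<Rightarrow> 'b::topological_space"
  shows "(f \<longlongrightarrow> l) F \<longleftrightarrow> (\<forall>x. ((\<lambda>i. f i x) \<longlongrightarrow> l x) F)"
  by (simp add: limitin_componentwise flip: limitin_canonical_iff euclidean_product_topology)

text \<open>All subsequences of a convergent orbit share its limit. Uniqueness of limits is applied
  coordinate by coordinate, where the Hausdorff property of \<open>'b\<close> is available.\<close>

lemma omega_limit_of_tendsto:
  fixes T :: "('a \<Rightarrow> 'b::t2_space) \<Rightarrow> 'a \<Rightarrow> 'b"
  assumes lim: "(\<lambda>m. (T ^^ m) x) \<longlonglongrightarrow> y"
  shows "omega_limit T x = {y}"
proof -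
  have sub: "(\<lambda>k. (T ^^ r k) x) \<longlonglongrightarrow> y" if "strict_mono r" for r :: "nat \<Rightarrow> nat"
    using LIMSEQ_subseq_LIMSEQ[OF lim that] by (simp add: o_def)
  have "z = y" if z: "z \<in> omega_limit T x" for z
  proof
    fix i
    obtain r :: "nat \<Rightarrow> nat" where "strict_mono r" "(\<lambda>k. (T ^^ r k) x) \<longlonglongrightarrow> z"
      using z by (auto simp: omega_limit_def)
    with sub show "z i = y i"
      unfolding tendsto_pointwise_iff by (blast intro: LIMSEQ_unique)
  qed
  moreover have "y \<in> omega_limit T x"
    using lim strict_mono_id unfolding omega_limit_def by force
  ultimately show ?thesis
    by blast
qed

text \<open>Monotonicity gives a limit \<open>l\<close> of the full sequence, so the contraction
  over \<open>N\<close> steps survives the passage to the limit: \<open>l \<le> (1 - c) * l\<close>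
  forces \<open>l \<le> 0\<close>.\<close>

lemma tendsto_zero_of_contraction:
  fixes a :: "nat \<Rightarrow> real"
  assumes nonneg: "\<And>m. 0 \<le> a m" and dec: "\<And>m. a (Suc m) \<le> a m"
    and contr: "\<And>m. a (m + N) \<le> (1 - c) * a m" and "c > 0"
  shows "a \<longlonglongrightarrow> 0"
proof -
  have "decseq a"
    using dec by (rule decseq_SucI)
  then obtain l where l: "a \<longlonglongrightarrow> l"
    using decseq_convergent[of a 0] nonneg by blast
  have "l \<le> (1 - c) * l"
    using LIMSEQ_le[OF LIMSEQ_ignore_initial_segment[OF l, of N] tendsto_mult_left[OF l, of "1 - c"]]
      contr by blast
  hence "c * l \<le> 0"
    by (simp add: algebra_simps)
  hence "l \<le> 0"
    using \<open>c > 0\<close> by (simp add: mult_le_0_iff)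
  moreover have "0 \<le> l"
    using LIMSEQ_le_const[OF l] nonneg by blast
  ultimately show ?thesis
    using l by simp
qed

section \<open>Coefficient functions and bilinearity of convolution\<close>

lemma signed_measures_eqI:
  assumes "\<mu> \<in> signed_measures G" "\<rho> \<in> signed_measures G"
    and "\<And>x. x \<in> carrier G \<Longrightarrow> \<mu> x = \<rho> x"
  shows "\<mu> = \<rho>"
  using assms by (fastforce simp: signed_measures_def)

lemma prob_measures_iff:
  assumes "finite (carrier G)"
  shows "\<mu> \<in> prob_measures G \<longleftrightarrow>
    \<mu> \<in> signed_measures G \<and> (\<forall>g\<in>carrier G. 0 \<le> \<mu> g) \<and> (\<Sum>g\<in>carrier G. \<mu> g) = 1"
  using member_le_sum[of _ "carrier G" \<mu>] assms by (fastforce simp: prob_measures_def)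

lemma uniform_measure_on_eq:
  assumes "finite H"
  shows "uniform_measure_on H x = (if x \<in> H then 1 / real (card H) else 0)"
proof -
  have "(1 / real (card H)) * dirac h x = (if x = h then 1 / real (card H) else 0)" for h
    by (simp add: dirac_def indicator_def)
  with assms show ?thesis
    by (simp add: uniform_measure_on_def)
qed

lemma conv_diff_left: "conv G (\<lambda>g. \<nu> g - \<rho> g) \<mu> x = conv G \<nu> \<mu> x - conv G \<rho> \<mu> x"
  by (simp add: conv_def left_diff_distrib sum_subtractf)

lemma conv_scale_left: "conv G (\<lambda>g. c * \<nu> g) \<mu> x = c * conv G \<nu> \<mu> x"
  by (simp add: conv_def sum_distrib_left mult.assoc)

lemma conv_linear_right:
  "conv G \<nu> (\<lambda>g. a * \<mu> g + b * \<rho> g) x = a * conv G \<nu> \<mu> x + b * conv G \<nu> \<rho> x"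
  by (simp add: conv_def sum_distrib_left sum.distrib algebra_simps)

lemma conv_diff_right: "conv G \<nu> (\<lambda>g. \<mu> g - \<rho> g) x = conv G \<nu> \<mu> x - conv G \<nu> \<rho> x"
  using conv_linear_right[of G \<nu> 1 \<mu> "-1" \<rho> x] by simp

section \<open>Convolution on a finite group\<close>

context group
begin

lemma conv_signed: "conv G \<nu> \<mu> \<in> signed_measures G"
  by (auto simp: conv_def signed_measures_def dirac_def indicator_def intro!: sum.neutral)

lemma conv_nonneg:
  assumes "\<And>g. g \<in> carrier G \<Longrightarrow> 0 \<le> \<nu> g" "\<And>g. g \<in> carrier G \<Longrightarrow> 0 \<le> \<mu> g"
  shows "0 \<le> conv G \<nu> \<mu> x"
  using assms by (auto simp: conv_def dirac_def intro!: sum_nonneg mult_nonneg_nonneg)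

text \<open>For fixed \<open>g\<close>, the equation \<open>g \<otimes> h = x\<close> has the single
  solution \<open>h = inv g \<otimes> x\<close>, so the inner sum collapses to one term.\<close>

lemma conv_left:
  assumes fin: "finite (carrier G)" and x: "x \<in> carrier G"
  shows "conv G \<nu> \<mu> x = (\<Sum>g\<in>carrier G. \<nu> g * \<mu> (inv g \<otimes> x))"
  unfolding conv_def
proof (rule sum.cong[OF refl])
  fix g assume g: "g \<in> carrier G"
  have "\<nu> g * \<mu> h * dirac (g \<otimes> h) x = (if h = inv g \<otimes> x then \<nu> g * \<mu> (inv g \<otimes> x) else 0)"
    if h: "h \<in> carrier G" for h
    using inv_solve_left[OF h g x] by (auto simp: dirac_def indicator_def)
  with fin g x show "(\<Sum>h\<in>carrier G. \<nu> g * \<mu> h * dirac (g \<otimes> h) x) = \<nu> g * \<mu> (inv g \<otimes> x)"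
    by simp
qed

lemma conv_right:
  assumes fin: "finite (carrier G)" and x: "x \<in> carrier G"
  shows "conv G \<nu> \<mu> x = (\<Sum>h\<in>carrier G. \<nu> (x \<otimes> inv h) * \<mu> h)"
  unfolding conv_def
proof (subst sum.swap, rule sum.cong[OF refl])
  fix h assume h: "h \<in> carrier G"
  have "\<nu> g * \<mu> h * dirac (g \<otimes> h) x = (if g = x \<otimes> inv h then \<nu> (x \<otimes> inv h) * \<mu> h else 0)"
    if g: "g \<in> carrier G" for g
    using inv_solve_right[OF g x h] by (auto simp: dirac_def indicator_def)
  with fin h x show "(\<Sum>g\<in>carrier G. \<nu> g * \<mu> h * dirac (g \<otimes> h) x) = \<nu> (x \<otimes> inv h) * \<mu> h"
    by simp
qed

text \<open>This is the integral formula for the constant function 1.\<close>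

lemma sum_conv:
  assumes "finite (carrier G)"
  shows "(\<Sum>x\<in>carrier G. conv G \<nu> \<mu> x) = (\<Sum>g\<in>carrier G. \<nu> g) * (\<Sum>g\<in>carrier G. \<mu> g)"
  using integral_conv[OF is_group assms, of \<nu> \<mu> "\<lambda>_. 1"] by (simp add: sum_product)

lemma conv_prob:
  assumes "finite (carrier G)" "\<nu> \<in> prob_measures G" "\<mu> \<in> prob_measures G"
  shows "conv G \<nu> \<mu> \<in> prob_measures G"
  using assms by (simp add: prob_measures_iff conv_signed conv_nonneg sum_conv)

text \<open>Submultiplicativity of total variation: the triangle inequality bounds the convolution
  by that of the absolute values, whose total mass is multiplicative.\<close>

lemma sum_abs_conv_le:
  assumes "finite (carrier G)"
  shows "(\<Sum>x\<in>carrier G. \<bar>conv G \<nu> \<mu> x\<bar>)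
    \<le> (\<Sum>g\<in>carrier G. \<bar>\<nu> g\<bar>) * (\<Sum>g\<in>carrier G. \<bar>\<mu> g\<bar>)"
proof -
  have "\<bar>conv G \<nu> \<mu> x\<bar> \<le> conv G (\<lambda>g. \<bar>\<nu> g\<bar>) (\<lambda>g. \<bar>\<mu> g\<bar>) x" if "x \<in> carrier G" for x
    using sum_abs[of "\<lambda>g. \<nu> g * \<mu> (inv g \<otimes> x)" "carrier G"] assms that
    by (simp add: conv_left abs_mult)
  hence "(\<Sum>x\<in>carrier G. \<bar>conv G \<nu> \<mu> x\<bar>)
      \<le> (\<Sum>x\<in>carrier G. conv G (\<lambda>g. \<bar>\<nu> g\<bar>) (\<lambda>g. \<bar>\<mu> g\<bar>) x)"
    by (rule sum_mono)
  thus ?thesis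
    by (simp add: sum_conv assms)
qed

text \<open>Both sides are the double sum of \<open>\<nu> g * \<mu> (inv g \<otimes> x \<otimes> inv
  h) * \<rho> h\<close>. Expanding by the left formula in \<open>g\<close> and the right formula in
  \<open>h\<close> avoids any reindexing.\<close>

lemma conv_assoc:
  assumes fin: "finite (carrier G)"
  shows "conv G (conv G \<nu> \<mu>) \<rho> = conv G \<nu> (conv G \<mu> \<rho>)"
proof (rule signed_measures_eqI[OF conv_signed conv_signed])
  fix x assume x: "x \<in> carrier G"
  have "conv G (conv G \<nu> \<mu>) \<rho> x
      = (\<Sum>h\<in>carrier G. \<Sum>g\<in>carrier G. \<nu> g * \<mu> (inv g \<otimes> (x \<otimes> inv h)) * \<rho> h)"
    using fin x by (subst conv_right) (simp_all add: conv_left sum_distrib_right)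
  also have "\<dots> = (\<Sum>g\<in>carrier G. \<Sum>h\<in>carrier G. \<nu> g * (\<mu> (inv g \<otimes> x \<otimes> inv h) * \<rho> h))"
    using x by (subst sum.swap) (simp add: m_assoc mult.assoc)
  also have "\<dots> = conv G \<nu> (conv G \<mu> \<rho>) x"
    using fin x by (subst conv_left) (simp_all add: conv_right sum_distrib_left)
  finally show "conv G (conv G \<nu> \<mu>) \<rho> x = conv G \<nu> (conv G \<mu> \<rho>) x" .
qed

section \<open>The unit, convolution powers and their positivity\<close>

lemma dirac_one_prob: "finite (carrier G) \<Longrightarrow> dirac \<one> \<in> prob_measures G"
  by (auto simp: prob_measures_iff signed_measures_def dirac_def indicator_def)

lemma conv_dirac_one_left:
  assumes fin: "finite (carrier G)" and \<mu>: "\<mu> \<in> signed_measures G"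
  shows "conv G (dirac \<one>) \<mu> = \<mu>"
proof (rule signed_measures_eqI[OF conv_signed \<mu>])
  fix x assume x: "x \<in> carrier G"
  have "dirac \<one> g * \<mu> (inv g \<otimes> x) = (if g = \<one> then \<mu> x else 0)" for g
    using x by (simp add: dirac_def)
  with fin x show "conv G (dirac \<one>) \<mu> x = \<mu> x"
    by (simp add: conv_left)
qed

lemma conv_dirac_one_right:
  assumes fin: "finite (carrier G)" and \<mu>: "\<mu> \<in> signed_measures G"
  shows "conv G \<mu> (dirac \<one>) = \<mu>"
proof (rule signed_measures_eqI[OF conv_signed \<mu>])
  fix x assume x: "x \<in> carrier G"
  have "\<mu> (x \<otimes> inv h) * dirac \<one> h = (if h = \<one> then \<mu> x else 0)" for h
    using x by (simp add: dirac_def)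
  with fin x show "conv G \<mu> (dirac \<one>) x = \<mu> x"
    by (simp add: conv_right)
qed

lemma conv_pow_prob:
  "finite (carrier G) \<Longrightarrow> \<nu> \<in> prob_measures G \<Longrightarrow> conv_pow G \<nu> m \<in> prob_measures G"
  by (induction m) (simp_all add: dirac_one_prob conv_prob)

text \<open>Associativity trades \<open>m\<close> applications of the operator for one convolution
  with the \<open>m\<close>-th power, whose positivity can then be exploited.\<close>

lemma funpow_conv:
  assumes "finite (carrier G)" "\<mu> \<in> signed_measures G"
  shows "(conv G \<nu> ^^ m) \<mu> = conv G (conv_pow G \<nu> m) \<mu>"
  by (induction m) (use assms in \<open>simp_all add: conv_dirac_one_left conv_assoc\<close>)

lemma conv_mult_pos:
  assumes fin: "finite (carrier G)"
    and nonneg: "\<And>x. x \<in> carrier G \<Longrightarrow> 0 \<le> \<nu> x" "\<And>x. x \<in> carrier G \<Longrightarrow> 0 \<le> \<mu> x"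
    and g: "g \<in> carrier G" and h: "h \<in> carrier G" and pos: "0 < \<nu> g" "0 < \<mu> h"
  shows "0 < conv G \<nu> \<mu> (g \<otimes> h)"
proof -
  have "inv g \<otimes> (g \<otimes> h) = h"
    using g h by (simp add: m_assoc[symmetric])
  hence "0 < \<nu> g * \<mu> (inv g \<otimes> (g \<otimes> h))"
    using pos by simp
  also have "\<dots> \<le> (\<Sum>k\<in>carrier G. \<nu> k * \<mu> (inv k \<otimes> (g \<otimes> h)))"
    using fin g h nonneg by (intro member_le_sum[of g]) auto
  finally show ?thesis
    using fin g h by (simp add: conv_left)
qed

text \<open>Induction on the word: \<open>foldr\<close> peels off the leftmost letter just as
  \<open>conv_pow\<close> peels off its leftmost factor. This turns acyclicity into positivity of a
  power on the whole generated subgroup.\<close>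

lemma conv_pow_pos_of_supp_products:
  assumes fin: "finite (carrier G)" and \<nu>: "\<nu> \<in> prob_measures G"
    and x: "x \<in> supp_products G \<nu> m"
  shows "0 < conv_pow G \<nu> m x"
proof -
  \<comment> \<open>Carrier membership is carried along because \<open>conv_mult_pos\<close> asks
    for it at the tail of the word.\<close>
  have "foldr (\<otimes>) gs \<one> \<in> carrier G \<and> 0 < conv_pow G \<nu> (length gs) (foldr (\<otimes>) gs \<one>)"
    if "set gs \<subseteq> supp G \<nu>" for gs
    using that
  proof (induction gs)
    case Nil
    show ?case by (simp add: dirac_def)
  next
    case (Cons g gs)
    have "\<And>x. x \<in> carrier G \<Longrightarrow> 0 \<le> \<nu> x" "\<And>x. x \<in> carrier G \<Longrightarrow> 0 \<le> conv_pow G \<nu> (length gs) x"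
      using \<nu> conv_pow_prob[OF fin \<nu>, of "length gs"] by (auto simp: prob_measures_iff fin)
    with Cons show ?case
      by (auto simp: supp_def intro!: conv_mult_pos[OF fin])
  qed
  with x show ?thesis
    by (auto simp: supp_products_def)
qed

section \<open>The uniform measure on a subgroup\<close>

lemma uniform_measure_on_prob:
  assumes fin: "finite (carrier G)" and H: "subgroup H G"
  shows "uniform_measure_on H \<in> prob_measures G"
proof -
  have sub: "H \<subseteq> carrier G"
    using H by (rule subgroup.subset)
  have finH: "finite H"
    using sub fin by (rule finite_subset)
  have "H \<noteq> {}"
    using subgroup.one_closed[OF H] by blast
  have "(\<Sum>g\<in>carrier G. uniform_measure_on H g) = (\<Sum>g\<in>H. 1 / real (card H))"
    using sub fin by (intro sum.mono_neutral_cong_right) (auto simp: uniform_measure_on_eq finH)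
  also have "\<dots> = 1"
    using finH \<open>H \<noteq> {}\<close> by simp
  finally show ?thesis
    using sub by (auto simp: prob_measures_iff fin signed_measures_def uniform_measure_on_eq finH)
qed

text \<open>Right translation by an element of \<open>H\<close> preserves \<open>H\<close>, so the
  uniform coefficient is constant along the terms with \<open>h \<in> H\<close>, and the mass 1 of
  \<open>\<nu>\<close> factors out.\<close>

lemma conv_uniform_left:
  assumes fin: "finite (carrier G)" and H: "subgroup H G" and \<nu>: "\<nu> \<in> prob_measures G"
    and zero: "\<And>g. g \<in> carrier G \<Longrightarrow> g \<notin> H \<Longrightarrow> \<nu> g = 0"
  shows "conv G (uniform_measure_on H) \<nu> = uniform_measure_on H"
proof (rule signed_measures_eqI[OF conv_signed])
  let ?u = "uniform_measure_on H"
  have finH: "finite H"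
    using subgroup.subset[OF H] fin by (rule finite_subset)
  show "?u \<in> signed_measures G"
    using uniform_measure_on_prob[OF fin H] by (simp add: prob_measures_iff fin)
  fix x assume x: "x \<in> carrier G"
  have "?u (x \<otimes> inv h) * \<nu> h = ?u x * \<nu> h" if h: "h \<in> carrier G" for h
  proof (cases "h \<in> H")
    case True
    have "x \<otimes> inv h \<in> H \<longleftrightarrow> x \<in> H"
    proof
      assume "x \<otimes> inv h \<in> H"
      hence "x \<otimes> inv h \<otimes> h \<in> H"
        using True H by (simp add: subgroup.m_closed)
      thus "x \<in> H"
        using x h by (simp add: m_assoc)
    qed (use True H in \<open>simp add: subgroup.m_closed subgroup.m_inv_closed\<close>)
    thus ?thesis
      by (simp add: uniform_measure_on_eq finH)
  qed (use zero h in simp)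
  hence "conv G ?u \<nu> x = ?u x * (\<Sum>h\<in>carrier G. \<nu> h)"
    unfolding conv_right[OF fin x] sum_distrib_left by (rule sum.cong[OF refl])
  thus "conv G ?u \<nu> x = ?u x"
    using \<nu> by (simp add: prob_measures_iff fin)
qed

text \<open>The mirror image, with left translations; it is argued separately as \<open>G\<close>
  may be non-abelian.\<close>

lemma conv_uniform_right:
  assumes fin: "finite (carrier G)" and H: "subgroup H G" and \<nu>: "\<nu> \<in> prob_measures G"
    and zero: "\<And>g. g \<in> carrier G \<Longrightarrow> g \<notin> H \<Longrightarrow> \<nu> g = 0"
  shows "conv G \<nu> (uniform_measure_on H) = uniform_measure_on H"
proof (rule signed_measures_eqI[OF conv_signed])
  let ?u = "uniform_measure_on H"
  have finH: "finite H"
    using subgroup.subset[OF H] fin by (rule finite_subset)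
  show "?u \<in> signed_measures G"
    using uniform_measure_on_prob[OF fin H] by (simp add: prob_measures_iff fin)
  fix x assume x: "x \<in> carrier G"
  have "\<nu> g * ?u (inv g \<otimes> x) = \<nu> g * ?u x" if g: "g \<in> carrier G" for g
  proof (cases "g \<in> H")
    case True
    have "inv g \<otimes> x \<in> H \<longleftrightarrow> x \<in> H"
    proof
      assume "inv g \<otimes> x \<in> H"
      hence "g \<otimes> (inv g \<otimes> x) \<in> H"
        using True H by (simp add: subgroup.m_closed)
      thus "x \<in> H"
        using x g by (simp add: m_assoc[symmetric])
    qed (use True H in \<open>simp add: subgroup.m_closed subgroup.m_inv_closed\<close>)
    thus ?thesis
      by (simp add: uniform_measure_on_eq finH)
  qed (use zero g in simp)
  hence "conv G \<nu> ?u x = (\<Sum>g\<in>carrier G. \<nu> g) * ?u x"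
    unfolding conv_left[OF fin x] sum_distrib_right by (rule sum.cong[OF refl])
  thus "conv G \<nu> ?u x = ?u x"
    using \<nu> by (simp add: prob_measures_iff fin)
qed

section \<open>Convergence of orbits\<close>

theorem tendsto_conv_uniform:
  assumes fin: "finite (carrier G)" and \<nu>: "\<nu> \<in> prob_measures G"
    and acyclic: "acyclic_measure G \<nu>" and H: "H = generate G (supp G \<nu>)"
    and \<mu>: "\<mu> \<in> signed_measures G"
  shows "(\<lambda>m. (conv G \<nu> ^^ m) \<mu>) \<longlonglongrightarrow> conv G (uniform_measure_on H) \<mu>"
proof -
  define u where "u = uniform_measure_on H"
  have subH: "subgroup H G"
    unfolding H by (rule generate_is_subgroup) (auto simp: supp_def)
  have finH: "finite H"
    using subgroup.subset[OF subH] fin by (rule finite_subset)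
  have one: "\<one> \<in> H"
    using subH by (rule subgroup.one_closed)
  have zero: "\<nu> g = 0" if "g \<in> carrier G" "g \<notin> H" for g
  proof -
    have "g \<notin> supp G \<nu>"
      using that generate.incl unfolding H by fast
    with that \<nu> show ?thesis
      by (force simp: supp_def prob_measures_iff fin)
  qed
  have u: "u \<in> prob_measures G"
    unfolding u_def by (rule uniform_measure_on_prob[OF fin subH])
  \<comment> \<open>Idempotence of \<open>u\<close> is the absorption law applied to
    \<open>u\<close> itself, which also vanishes off \<open>H\<close>.\<close>
  have \<nu>u: "conv G \<nu> u = u" and u\<nu>: "conv G u \<nu> = u" and uu: "conv G u u = u"
    unfolding u_def using fin subH \<nu> zero u[unfolded u_def]
    by (auto intro!: conv_uniform_left conv_uniform_right simp: uniform_measure_on_eq finH)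
  obtain N where N: "supp_products G \<nu> N = H"
    using acyclic unfolding acyclic_measure_def H by blast
  define P where "P = conv_pow G \<nu> N"
  have P: "P \<in> prob_measures G"
    unfolding P_def by (rule conv_pow_prob[OF fin \<nu>])
  \<comment> \<open>Every point of \<open>H\<close> is a product of \<open>N\<close> support
    elements, so \<open>P\<close> is positive on the finite nonempty set \<open>H\<close> and its
    minimum there is positive.\<close>
  define c where "c = Min (P ` H)"
  have "c > 0"
    unfolding c_def P_def using finH one conv_pow_pos_of_supp_products[OF fin \<nu>, of _ N]
    by (subst Min_gr_iff) (auto simp: N)
  have minor: "c * u g \<le> P g" if "g \<in> carrier G" for g
  proof (cases "g \<in> H")
    case True
    have "0 < card H"
      using finH one card_gt_0_iff by blast
    hence "u g \<le> 1"
      using True by (simp add: u_def uniform_measure_on_eq finH)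
    hence "c * u g \<le> c"
      using \<open>c > 0\<close> by (simp add: mult_left_le)
    also have "c \<le> P g"
      using True finH by (simp add: c_def)
    finally show ?thesis .
  next
    case False
    thus ?thesis
      using that P by (simp add: u_def uniform_measure_on_eq finH prob_measures_iff fin)
  qed
  define d where "d m = (\<lambda>x. (conv G \<nu> ^^ m) \<mu> x - conv G u \<mu> x)" for m
  define a where "a m = (\<Sum>x\<in>carrier G. \<bar>d m x\<bar>)" for m
  have iter_signed: "(conv G \<nu> ^^ m) \<mu> \<in> signed_measures G" for m
    by (cases m) (simp_all add: \<mu> conv_signed)
  have d_signed: "d m \<in> signed_measures G" for m
    using iter_signed[of m] conv_signed[of u \<mu>] by (simp add: d_def signed_measures_def)
  have d_Suc: "d (Suc m) = conv G \<nu> (d m)" for m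
    by (rule ext) (simp add: d_def conv_diff_right conv_assoc[OF fin, symmetric] \<nu>u)
  \<comment> \<open>Seeing \<open>d\<close> as an orbit itself lets \<open>N\<close> further steps
    be rewritten as one convolution with \<open>P\<close>.\<close>
  have "d m = (conv G \<nu> ^^ m) (d 0)" for m
    by (induction m) (simp_all add: d_Suc)
  hence d_add: "d (m + N) = conv G P (d m)" for m
    by (metis P_def add.commute comp_apply d_signed funpow_add funpow_conv[OF fin])
  have u_iter: "conv G u ((conv G \<nu> ^^ m) \<mu>) = conv G u \<mu>" for m
    by (induction m) (simp_all add: conv_assoc[OF fin, symmetric] u\<nu>)
  have u_d: "conv G u (d m) x = 0" for m x
    by (simp add: d_def conv_diff_right u_iter conv_assoc[OF fin, symmetric] uu)
  have "a \<longlonglongrightarrow> 0"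
  proof (rule tendsto_zero_of_contraction[OF _ _ _ \<open>c > 0\<close>])
    fix m
    show "0 \<le> a m"
      by (simp add: a_def sum_nonneg)
    have "(\<Sum>g\<in>carrier G. \<bar>\<nu> g\<bar>) = 1"
      using \<nu> by (simp add: prob_measures_iff fin)
    thus "a (Suc m) \<le> a m"
      using sum_abs_conv_le[OF fin, of \<nu> "d m"] by (simp add: a_def d_Suc)
    \<comment> \<open>Since \<open>u\<close> annihilates \<open>d m\<close>, subtracting
      \<open>c * u\<close> changes nothing in the convolution. By \<open>minor\<close> the reduced
      kernel is nonnegative, so its total variation is its mass \<open>1 - c\<close>.\<close>
    have "d (m + N) = conv G (\<lambda>g. P g - c * u g) (d m)"
      by (rule ext) (simp add: d_add conv_diff_left conv_scale_left u_d)
    moreover have "(\<Sum>g\<in>carrier G. \<bar>P g - c * u g\<bar>) = (\<Sum>g\<in>carrier G. P g - c * u g)"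
      using minor by simp
    moreover have "\<dots> = 1 - c"
      using P u by (simp add: sum_subtractf sum_distrib_left[symmetric] prob_measures_iff fin)
    ultimately show "a (m + N) \<le> (1 - c) * a m"
      using sum_abs_conv_le[OF fin, of "\<lambda>g. P g - c * u g" "d m"] by (simp add: a_def)
  qed
  \<comment> \<open>Convergence of functions concerns every \<open>x\<close>; outside the carrier
    \<open>d m\<close> is zero.\<close>
  have "\<bar>d m x\<bar> \<le> a m" for m x
  proof (cases "x \<in> carrier G")
    case True
    thus ?thesis
      unfolding a_def using fin by (intro member_le_sum[of x _ "\<lambda>x. \<bar>d m x\<bar>"]) auto
  next
    case False
    thus ?thesis
      using d_signed[of m] by (simp add: a_def signed_measures_def sum_nonneg)
  qed
  hence "(\<lambda>m. d m x) \<longlonglongrightarrow> 0" for x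
    by (intro tendsto_rabs_zero_cancel[OF tendsto_sandwich[OF _ _ tendsto_const \<open>a \<longlonglongrightarrow> 0\<close>]])
      simp_all
  hence "(\<lambda>m. (conv G \<nu> ^^ m) \<mu> x) \<longlonglongrightarrow> conv G u \<mu> x" for x
    unfolding d_def by (rule LIM_zero_cancel)
  thus ?thesis
    unfolding u_def by (simp add: tendsto_pointwise_iff)
qed

end

theorem theorem27:
  fixes G :: "('a, 'b) monoid_scheme" and \<nu> :: "'a \<Rightarrow> real" and H :: "'a set"
  assumes "group G" and "finite (carrier G)"
    and "\<nu> \<in> prob_measures G" and "acyclic_measure G \<nu>"
    and "H = generate G (supp G \<nu>)"
  shows "(\<forall>\<mu>\<in>prob_measures G.
            omega_limit (conv G \<nu>) \<mu> = {conv G (uniform_measure_on H) \<mu>}) \<and>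
         (\<exists>L. linear_on_measures G L \<and>
              (\<forall>\<mu>\<in>prob_measures G.
                 omega_limit (conv G \<nu>) \<mu> = {L \<mu>} \<and>
                 (\<lambda>m. (conv G \<nu> ^^ m) \<mu>) \<longlonglongrightarrow> L \<mu>)) \<and>
         (\<exists>\<nu>bar\<in>prob_measures G.
            (\<lambda>m. conv_pow G \<nu> m) \<longlonglongrightarrow> \<nu>bar \<and>
            (\<forall>\<mu>\<in>prob_measures G.
               \<mu> \<in> omega_limit (conv G \<nu>) \<mu> \<longrightarrow> conv G \<nu>bar \<mu> = \<mu>))"
proof -
  interpret group G by fact
  let ?u = "uniform_measure_on H"
  note fin = \<open>finite (carrier G)\<close>
  have signed: "\<mu> \<in> signed_measures G" if "\<mu> \<in> prob_measures G" for \<mu>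
    using that by (simp add: prob_measures_def)
  have lim: "(\<lambda>m. (conv G \<nu> ^^ m) \<mu>) \<longlonglongrightarrow> conv G ?u \<mu>" if "\<mu> \<in> prob_measures G" for \<mu>
    using tendsto_conv_uniform assms(2-5) signed[OF that] by blast
  have omega: "omega_limit (conv G \<nu>) \<mu> = {conv G ?u \<mu>}" if "\<mu> \<in> prob_measures G" for \<mu>
    using lim[OF that] by (rule omega_limit_of_tendsto)
  have "subgroup H G"
    unfolding assms(5) by (rule generate_is_subgroup) (auto simp: supp_def)
  hence u: "?u \<in> prob_measures G"
    by (rule uniform_measure_on_prob[OF fin])
  \<comment> \<open>The powers of \<open>\<nu>\<close> are the orbit of the unit mass at the
    identity, which identifies their limit as the uniform measure.\<close>
  have "(conv G \<nu> ^^ m) (dirac \<one>\<^bsub>G\<^esub>) = conv_pow G \<nu> m" for m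
    by (induction m) simp_all
  hence pow: "(\<lambda>m. conv_pow G \<nu> m) \<longlonglongrightarrow> ?u"
    using lim[OF dirac_one_prob[OF fin]] conv_dirac_one_right[OF fin signed[OF u]] by simp
  have "linear_on_measures G (conv G ?u)"
    by (auto simp: linear_on_measures_def conv_signed conv_linear_right)
  \<comment> \<open>With the limit of the powers equal to \<open>?u\<close>, recurrence means
    membership in the singleton of \<open>conv G ?u \<mu>\<close>, which is exactly the Choquet-Deny
    equation.\<close>
  with omega lim u pow show ?thesis
    by (intro conjI ballI exI[of _ "conv G ?u"] bexI[of _ ?u]) auto
qed

end
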